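(* Let $S$ and $W$ be compact manifolds and let $\pi:M\to\overline{M}$ be a multi-fiber bundle with fibers $(S,W)$ and multi-fiber atlas $(\overline{U}_\alpha,\phi_\alpha)_{\alpha\in A}$, $\phi_\alpha=(\pi,h_\alpha,f_\alpha)$. Let $H\subset\mathrm{Diff}(S)$ be the subgroup generated by all the diffeomorphisms $h_{\alpha\beta}(p)=h_\alpha|_{S_p}\circ(h_\beta|_{S_p})^{-1}$, for $\alpha,\beta\in A$ and $p\in\pi^{-1}(\overline{U}_\alpha\cap\overline{U}_\beta)$. Let $f\in C^\infty(S)$ be $H$-invariant, i.e. $f\circ h=f$ for all $h\in H$. Then setting $\tilde f(p):=f(h_\alpha(p))$ for any $\alpha\in A$ with $p\in\pi^{-1}(\overline{U}_\alpha)$ gives a well-defined (independent of the choice of $\alpha$) smooth function $\tilde f$ on $M$.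
   Context: Multi-fiber bundle: let $S,W$ be compact manifolds and let $\pi:M\to\overline{M}$ be a smooth fiber bundle with fiber $S\times W$. A bundle chart is a pair $(\overline{U},\phi)$ with $\overline{U}\subset\overline{M}$ open and $\phi:\pi^{-1}(\overline{U})\to\overline{U}\times S\times W$ a diffeomorphism whose first component is $\pi$; write $\phi=(\pi,h,f)$ with $h:\pi^{-1}(\overline{U})\to S$ and $f:\pi^{-1}(\overline{U})\to W$. A bundle atlas is a family of bundle charts whose domains $\overline{U}$ cover $\overline{M}$. A bundle atlas $(\overline{U}_\alpha,\phi_\alpha)_{\alpha\in A}$, $\phi_\alpha=(\pi,h_\alpha,f_\alpha)$, is called an $(S,W)$-multi-fiber atlas if for all $\alpha,\beta\in A$ with $\overline{U}_\alpha\cap\overline{U}_\beta\neq\emptyset$ and all $p\in\pi^{-1}(\overline{U}_\alpha\cap\overline{U}_\beta)$: (i) $\phi_\alpha^{-1}(\{\pi(p)\}\times S\times\{f_\alpha(p)\})=\phi_\beta^{-1}(\{\pi(p)\}\times S\times\{f_\beta(p)\})$; (ii) $\phi_\alpha^{-1}(\{\pi(p)\}\times\{h_\alpha(p)\}\times W)=\phi_\beta^{-1}(\{\pi(p)\}\times\{h_\beta(p)\}\times W)$. The bundle is a multi-fiber bundle with fibers $(S,W)$ if it admits such an atlas. The $S$-fiber at $p\in M$ is $S_p:=\phi_\alpha^{-1}(\{\pi(p)\}\times S\times\{f_\alpha(p)\})$ for any $\alpha$ with $\pi(p)\in\overline{U}_\alpha$ (independent of $\alpha$ by (i)); the restriction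 $h_\alpha|_{S_p}:S_p\to S$ is a diffeomorphism. *)

theory Defs
  imports "HOL-Analysis.Analysis" "HOL-Algebra.Bij" "HOL-Algebra.Generated_Groups"
begin

section \<open>Smooth maps between subsets of Euclidean spaces\<close>

fun Ck_on :: "nat \<Rightarrow> 'a::euclidean_space set \<Rightarrow> ('a \<Rightarrow> 'b::euclidean_space) \<Rightarrow> bool" where
  "Ck_on 0 U f \<longleftrightarrow> continuous_on U f"
| "Ck_on (Suc k) U f \<longleftrightarrow>
     (\<forall>x\<in>U. f differentiable (at x)) \<and>
     (\<forall>v. Ck_on k U (\<lambda>x. frechet_derivative f (at x) v))"

text \<open>\<^const>\<open>Ck_on\<close> is only meaningful on open sets. A map on an arbitrary subset of a
  Euclidean space is smooth if it extends locally to a smooth map on an open set of the ambient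
  space. For relatively open subsets of a linear subspace this is ordinary smoothness.\<close>

definition smooth_on :: "'a::euclidean_space set \<Rightarrow> ('a \<Rightarrow> 'b::euclidean_space) \<Rightarrow> bool" where
  "smooth_on X f \<longleftrightarrow>
     (\<forall>x\<in>X. \<exists>U g. open U \<and> x \<in> U \<and> (\<forall>k. Ck_on k U g) \<and> (\<forall>y\<in>X \<inter> U. g y = f y))"

section \<open>Smooth manifolds\<close>

text \<open>The model of a manifold is a linear subspace of a Euclidean space, not the whole type: every
  type of class \<^class>\<open>euclidean_space\<close> has positive dimension, and dimension 0 is to be allowed.
  The atlas need not be maximal.\<close>

record ('a, 'e) manifold =
  mfd_topology :: "'a topology"
  mfd_model :: "'e set"
  mfd_charts :: "('a set \<times> ('a \<Rightarrow> 'e)) set"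

abbreviation points :: "('a, 'e) manifold \<Rightarrow> 'a set" where
  "points M \<equiv> topspace (mfd_topology M)"

definition smooth_manifold :: "('a, 'e::euclidean_space) manifold \<Rightarrow> bool" where
  "smooth_manifold M \<longleftrightarrow>
     Hausdorff_space (mfd_topology M) \<and> second_countable (mfd_topology M) \<and>
     subspace (mfd_model M) \<and>
     (\<forall>(U, c) \<in> mfd_charts M.
        openin (mfd_topology M) U \<and>
        openin (top_of_set (mfd_model M)) (c ` U) \<and>
        homeomorphic_map (subtopology (mfd_topology M) U) (top_of_set (c ` U)) c) \<and>
     points M = (\<Union>(U, c) \<in> mfd_charts M. U) \<and>
     (\<forall>(U, c) \<in> mfd_charts M. \<forall>(V, d) \<in> mfd_charts M.
        smooth_on (c ` (U \<inter> V)) (d \<circ> inv_into U c))"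

definition compact_manifold :: "('a, 'e::euclidean_space) manifold \<Rightarrow> bool" where
  "compact_manifold M \<longleftrightarrow> smooth_manifold M \<and> compact_space (mfd_topology M)"

definition open_submanifold :: "('a, 'e) manifold \<Rightarrow> 'a set \<Rightarrow> ('a, 'e) manifold" where
  "open_submanifold M O' =
     \<lparr> mfd_topology = subtopology (mfd_topology M) O',
       mfd_model = mfd_model M,
       mfd_charts = (\<lambda>(U, c). (U \<inter> O', c)) ` mfd_charts M \<rparr>"

definition prod_manifold ::
    "('a, 'e) manifold \<Rightarrow> ('b, 'f) manifold \<Rightarrow> ('a \<times> 'b, 'e \<times> 'f) manifold" where
  "prod_manifold M N =
     \<lparr> mfd_topology = prod_topology (mfd_topology M) (mfd_topology N),
       mfd_model = mfd_model M \<times> mfd_model N,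
       mfd_charts = {(U \<times> V, map_prod c d) | U c V d.
                       (U, c) \<in> mfd_charts M \<and> (V, d) \<in> mfd_charts N} \<rparr>"

definition real_line :: "(real, real) manifold" where
  "real_line = \<lparr> mfd_topology = euclidean, mfd_model = UNIV, mfd_charts = {(UNIV, id)} \<rparr>"

definition smooth_map ::
    "('a, 'e::euclidean_space) manifold \<Rightarrow> ('b, 'f::euclidean_space) manifold \<Rightarrow> ('a \<Rightarrow> 'b) \<Rightarrow> bool" where
  "smooth_map M N f \<longleftrightarrow>
     continuous_map (mfd_topology M) (mfd_topology N) f \<and>
     (\<forall>(U, c) \<in> mfd_charts M. \<forall>(V, d) \<in> mfd_charts N.
        smooth_on (c ` {p \<in> U. f p \<in> V}) (d \<circ> f \<circ> inv_into U c))"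

definition diffeomorphism ::
    "('a, 'e::euclidean_space) manifold \<Rightarrow> ('b, 'f::euclidean_space) manifold \<Rightarrow> ('a \<Rightarrow> 'b) \<Rightarrow> bool" where
  "diffeomorphism M N f \<longleftrightarrow>
     bij_betw f (points M) (points N) \<and> smooth_map M N f \<and>
     smooth_map N M (inv_into (points M) f)"

text \<open>Values of the function outside \<^term>\<open>points M\<close> are irrelevant.\<close>

definition C_infinity :: "('a, 'e::euclidean_space) manifold \<Rightarrow> ('a \<Rightarrow> real) set" where
  "C_infinity M = {f. smooth_map M real_line f}"

definition Diff :: "('a, 'e::euclidean_space) manifold \<Rightarrow> ('a \<Rightarrow> 'a) monoid" where
  "Diff M = (BijGroup (points M)) \<lparr> carrier := {h \<in> Bij (points M). diffeomorphism M M h} \<rparr>"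

section \<open>Multi-fiber bundles\<close>

definition over :: "('m, 'em) manifold \<Rightarrow> ('m \<Rightarrow> 'b) \<Rightarrow> 'b set \<Rightarrow> 'm set" where
  "over M \<pi> U = {p \<in> points M. \<pi> p \<in> U}"

definition bundle_chart ::
    "('m, 'em::euclidean_space) manifold \<Rightarrow> ('b, 'eb::euclidean_space) manifold \<Rightarrow>
     ('f, 'ef::euclidean_space) manifold \<Rightarrow> ('m \<Rightarrow> 'b) \<Rightarrow> 'b set \<Rightarrow> ('m \<Rightarrow> 'b \<times> 'f) \<Rightarrow> bool" where
  "bundle_chart M B F \<pi> U \<phi> \<longleftrightarrow>
     openin (mfd_topology B) U \<and>
     diffeomorphism (open_submanifold M (over M \<pi> U)) (prod_manifold (open_submanifold B U) F) \<phi> \<and>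
     (\<forall>p \<in> over M \<pi> U. fst (\<phi> p) = \<pi> p)"

definition bundle_atlas ::
    "('m, 'em::euclidean_space) manifold \<Rightarrow> ('b, 'eb::euclidean_space) manifold \<Rightarrow>
     ('f, 'ef::euclidean_space) manifold \<Rightarrow> ('m \<Rightarrow> 'b) \<Rightarrow>
     'i set \<Rightarrow> ('i \<Rightarrow> 'b set) \<Rightarrow> ('i \<Rightarrow> 'm \<Rightarrow> 'b \<times> 'f) \<Rightarrow> bool" where
  "bundle_atlas M B F \<pi> A U \<phi> \<longleftrightarrow>
     (\<forall>\<alpha>\<in>A. bundle_chart M B F \<pi> (U \<alpha>) (\<phi> \<alpha>)) \<and> (\<Union>\<alpha>\<in>A. U \<alpha>) = points B"

text \<open>Surjectivity of \<open>\<pi>\<close> is automatic unless the fiber is empty. Existence of an atlas is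
  stated for atlases indexed by their own charts, hence the index functions \<^const>\<open>fst\<close> and
  \<^const>\<open>snd\<close>.\<close>

definition fiber_bundle ::
    "('m, 'em::euclidean_space) manifold \<Rightarrow> ('b, 'eb::euclidean_space) manifold \<Rightarrow>
     ('f, 'ef::euclidean_space) manifold \<Rightarrow> ('m \<Rightarrow> 'b) \<Rightarrow> bool" where
  "fiber_bundle M B F \<pi> \<longleftrightarrow>
     smooth_manifold M \<and> smooth_manifold B \<and> smooth_manifold F \<and> smooth_map M B \<pi> \<and>
     (\<exists>A. bundle_atlas M B F \<pi> A fst snd)"

definition h_part :: "('i \<Rightarrow> 'm \<Rightarrow> 'b \<times> 's \<times> 'w) \<Rightarrow> 'i \<Rightarrow> 'm \<Rightarrow> 's" where
  "h_part \<phi> \<alpha> p = fst (snd (\<phi> \<alpha> p))"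

definition f_part :: "('i \<Rightarrow> 'm \<Rightarrow> 'b \<times> 's \<times> 'w) \<Rightarrow> 'i \<Rightarrow> 'm \<Rightarrow> 'w" where
  "f_part \<phi> \<alpha> p = snd (snd (\<phi> \<alpha> p))"

text \<open>The preimages of \<open>{\<pi> p} \<times> S \<times> {f\<^sub>\<alpha> p}\<close> and \<open>{\<pi> p} \<times> {h\<^sub>\<alpha> p} \<times> W\<close> under
  \<open>\<phi>\<^sub>\<alpha>\<close>, whose domain is the part of \<open>M\<close> over \<open>U\<^sub>\<alpha>\<close>.\<close>

definition S_slice ::
    "('m, 'em) manifold \<Rightarrow> ('s, 'es) manifold \<Rightarrow> ('m \<Rightarrow> 'b) \<Rightarrow>
     ('i \<Rightarrow> 'b set) \<Rightarrow> ('i \<Rightarrow> 'm \<Rightarrow> 'b \<times> 's \<times> 'w) \<Rightarrow> 'i \<Rightarrow> 'm \<Rightarrow> 'm set" where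
  "S_slice M S \<pi> U \<phi> \<alpha> p =
     {q \<in> over M \<pi> (U \<alpha>). \<phi> \<alpha> q \<in> {\<pi> p} \<times> points S \<times> {f_part \<phi> \<alpha> p}}"

definition W_slice ::
    "('m, 'em) manifold \<Rightarrow> ('w, 'ew) manifold \<Rightarrow> ('m \<Rightarrow> 'b) \<Rightarrow>
     ('i \<Rightarrow> 'b set) \<Rightarrow> ('i \<Rightarrow> 'm \<Rightarrow> 'b \<times> 's \<times> 'w) \<Rightarrow> 'i \<Rightarrow> 'm \<Rightarrow> 'm set" where
  "W_slice M W \<pi> U \<phi> \<alpha> p =
     {q \<in> over M \<pi> (U \<alpha>). \<phi> \<alpha> q \<in> {\<pi> p} \<times> {h_part \<phi> \<alpha> p} \<times> points W}"

definition multi_fiber_atlas ::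
    "('m, 'em::euclidean_space) manifold \<Rightarrow> ('b, 'eb::euclidean_space) manifold \<Rightarrow>
     ('s, 'es::euclidean_space) manifold \<Rightarrow> ('w, 'ew::euclidean_space) manifold \<Rightarrow> ('m \<Rightarrow> 'b) \<Rightarrow>
     'i set \<Rightarrow> ('i \<Rightarrow> 'b set) \<Rightarrow> ('i \<Rightarrow> 'm \<Rightarrow> 'b \<times> 's \<times> 'w) \<Rightarrow> bool" where
  "multi_fiber_atlas M B S W \<pi> A U \<phi> \<longleftrightarrow>
     bundle_atlas M B (prod_manifold S W) \<pi> A U \<phi> \<and>
     (\<forall>\<alpha>\<in>A. \<forall>\<beta>\<in>A. \<forall>p \<in> over M \<pi> (U \<alpha> \<inter> U \<beta>).
        S_slice M S \<pi> U \<phi> \<alpha> p = S_slice M S \<pi> U \<phi> \<beta> p \<and>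
        W_slice M W \<pi> U \<phi> \<alpha> p = W_slice M W \<pi> U \<phi> \<beta> p)"

definition multi_fiber_bundle ::
    "('m, 'em::euclidean_space) manifold \<Rightarrow> ('b, 'eb::euclidean_space) manifold \<Rightarrow>
     ('s, 'es::euclidean_space) manifold \<Rightarrow> ('w, 'ew::euclidean_space) manifold \<Rightarrow> ('m \<Rightarrow> 'b) \<Rightarrow> bool" where
  "multi_fiber_bundle M B S W \<pi> \<longleftrightarrow>
     fiber_bundle M B (prod_manifold S W) \<pi> \<and> (\<exists>A. multi_fiber_atlas M B S W \<pi> A fst snd)"

definition S_fiber ::
    "('m, 'em) manifold \<Rightarrow> ('s, 'es) manifold \<Rightarrow> ('m \<Rightarrow> 'b) \<Rightarrow>
     'i set \<Rightarrow> ('i \<Rightarrow> 'b set) \<Rightarrow> ('i \<Rightarrow> 'm \<Rightarrow> 'b \<times> 's \<times> 'w) \<Rightarrow> 'm \<Rightarrow> 'm set" where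
  "S_fiber M S \<pi> A U \<phi> p = (THE F. \<exists>\<alpha>\<in>A. \<pi> p \<in> U \<alpha> \<and> F = S_slice M S \<pi> U \<phi> \<alpha> p)"

text \<open>\<open>h\<^sub>\<alpha>|\<^bsub>S_p\<^esub> \<circ> (h\<^sub>\<beta>|\<^bsub>S_p\<^esub>)\<inverse>\<close>, extensional so as to be an element of
  \<^const>\<open>Bij\<close>.\<close>

definition h_transition ::
    "('m, 'em) manifold \<Rightarrow> ('s, 'es) manifold \<Rightarrow> ('m \<Rightarrow> 'b) \<Rightarrow>
     'i set \<Rightarrow> ('i \<Rightarrow> 'b set) \<Rightarrow> ('i \<Rightarrow> 'm \<Rightarrow> 'b \<times> 's \<times> 'w) \<Rightarrow> 'i \<Rightarrow> 'i \<Rightarrow> 'm \<Rightarrow> 's \<Rightarrow> 's" where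
  "h_transition M S \<pi> A U \<phi> \<alpha> \<beta> p =
     (\<lambda>s \<in> points S. h_part \<phi> \<alpha> (inv_into (S_fiber M S \<pi> A U \<phi> p) (h_part \<phi> \<beta>) s))"

definition transition_group ::
    "('m, 'em) manifold \<Rightarrow> ('s, 'es::euclidean_space) manifold \<Rightarrow> ('m \<Rightarrow> 'b) \<Rightarrow>
     'i set \<Rightarrow> ('i \<Rightarrow> 'b set) \<Rightarrow> ('i \<Rightarrow> 'm \<Rightarrow> 'b \<times> 's \<times> 'w) \<Rightarrow> ('s \<Rightarrow> 's) set" where
  "transition_group M S \<pi> A U \<phi> =
     generate (Diff S) {h_transition M S \<pi> A U \<phi> \<alpha> \<beta> p | \<alpha> \<beta> p.
       \<alpha> \<in> A \<and> \<beta> \<in> A \<and> p \<in> over M \<pi> (U \<alpha> \<inter> U \<beta>)}"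

definition invariant_under :: "('s \<Rightarrow> 's) set \<Rightarrow> ('s, 'es) manifold \<Rightarrow> ('s \<Rightarrow> real) \<Rightarrow> bool" where
  "invariant_under H S f \<longleftrightarrow> (\<forall>h\<in>H. \<forall>s\<in>points S. (f \<circ> h) s = f s)"

end

theory Submission
  imports Defs
begin

text \<open>The invariance hypothesis applied to a single generator \<open>h\<^sub>\<alpha>\<^sub>\<beta>(p)\<close>, which sends
  \<open>h\<^sub>\<beta>(p)\<close> to \<open>h\<^sub>\<alpha>(p)\<close>, gives independence of the chart.
  Over each \<open>U\<^sub>\<alpha>\<close> the resulting function is \<open>f \<circ> h\<^sub>\<alpha>\<close>, a composition of smooth maps, and
  smoothness is local.\<close>

section \<open>Calculus of smooth maps\<close>

text \<open>A derivative at \<open>x\<close> depends only on values near \<open>x\<close>. Since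
  \<open>U\<close> is open, agreement on \<open>U\<close> therefore passes to the directional
  derivatives at points of \<open>U\<close>, and the induction continues with these.\<close>

lemma Ck_on_cong:
  assumes "open U" "\<And>x. x \<in> U \<Longrightarrow> f x = g x" "Ck_on k U f"
  shows "Ck_on k U g"
  using assms(2,3)
proof (induction k arbitrary: f g)
  case 0
  then show ?case using continuous_on_cong by fastforce
next
  case (Suc k)
  have D: "(g has_derivative frechet_derivative f (at x)) (at x)" if "x \<in> U" for x
  proof -
    have "(f has_derivative frechet_derivative f (at x)) (at x)"
      using Suc.prems(2) that by (simp add: frechet_derivative_works)
    then show ?thesis
      by (rule has_derivative_transform_within_open[OF _ assms(1) that]) (simp add: Suc.prems(1))
  qed
  have "Ck_on k U (\<lambda>x. frechet_derivative g (at x) v)" for v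
  proof (rule Suc.IH)
    show "frechet_derivative f (at x) v = frechet_derivative g (at x) v" if "x \<in> U" for x
      using frechet_derivative_at[OF D[OF that]] by simp
    show "Ck_on k U (\<lambda>x. frechet_derivative f (at x) v)"
      using Suc.prems(2) by simp
  qed
  then show ?case using D by (auto simp: differentiable_def)
qed

text \<open>\<open>frechet_derivative\<close> is defined by choice, but derivatives are unique, so
  any explicit formula \<open>f'\<close> may replace it on \<open>U\<close>. The rules for sums,
  products and composition below enter their induction steps this way.\<close>

lemma Ck_on_SucI:
  assumes "open U" "\<And>x. x \<in> U \<Longrightarrow> (f has_derivative f' x) (at x)"
    and "\<And>v. Ck_on k U (\<lambda>x. f' x v)"
  shows "Ck_on (Suc k) U f"
proof -
  have "Ck_on k U (\<lambda>x. frechet_derivative f (at x) v)" for v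
    by (rule Ck_on_cong[OF assms(1) _ assms(3)[of v]])
       (metis assms(2) frechet_derivative_at)
  then show ?thesis using assms(2) by (auto simp: differentiable_def)
qed

lemma Ck_on_has_derivative:
  assumes "Ck_on (Suc k) U f" "x \<in> U"
  shows "(f has_derivative frechet_derivative f (at x)) (at x)"
  using assms by (simp add: frechet_derivative_works)

lemma Ck_on_subset: "Ck_on k U f \<Longrightarrow> V \<subseteq> U \<Longrightarrow> Ck_on k V f"
  by (induction k arbitrary: f) (auto intro: continuous_on_subset)

text \<open>The product and chain rules leave one factor undifferentiated, so their induction steps
  need the maps themselves at the lower order. At order 0 this is continuity of differentiable
  maps.\<close>

lemma Ck_on_SucD: "Ck_on (Suc k) U f \<Longrightarrow> Ck_on k U f"
proof (induction k arbitrary: f)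
  case 0
  then show ?case
    by (auto intro!: continuous_at_imp_continuous_on differentiable_imp_continuous_within)
next
  case (Suc k)
  then show ?case by (simp only: Ck_on.simps(2)) blast
qed

lemma Ck_on_const:
  assumes "open U"
  shows "Ck_on k U (\<lambda>_. c)"
proof (induction k arbitrary: c)
  case (Suc k)
  show ?case
    by (rule Ck_on_SucI[OF assms has_derivative_const Suc])
qed simp

lemma Ck_on_bounded_linear:
  assumes "open U" "bounded_linear L"
  shows "Ck_on k U L"
proof (cases k)
  case 0
  then show ?thesis using assms(2) by (simp add: linear_continuous_on)
next
  case (Suc k)
  then show ?thesis
    using Ck_on_SucI[OF assms(1) bounded_linear_imp_has_derivative[OF assms(2)]]
      Ck_on_const[OF assms(1)] by blast
qed

lemma Ck_on_add:
  assumes "open U" "Ck_on k U f" "Ck_on k U g"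
  shows "Ck_on k U (\<lambda>x. f x + g x)"
  using assms(2,3)
proof (induction k arbitrary: f g)
  case 0
  then show ?case by (simp add: continuous_on_add)
next
  case (Suc k)
  show ?case
    by (rule Ck_on_SucI[OF assms(1) has_derivative_add[OF Suc.prems[THEN Ck_on_has_derivative]]])
       (use Suc in simp_all)
qed

lemma Ck_on_sum:
  assumes "open U" "\<And>i. i \<in> I \<Longrightarrow> Ck_on k U (f i)"
  shows "Ck_on k U (\<lambda>x. \<Sum>i\<in>I. f i x)"
  using assms(2)
  by (induction I rule: infinite_finite_induct) (auto intro: Ck_on_add Ck_on_const assms(1))

lemma Ck_on_scaleR:
  assumes "open U" "Ck_on k U f" "Ck_on k U g"
  shows "Ck_on k U (\<lambda>x. f x *\<^sub>R g x)"
  using assms(2,3)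
proof (induction k arbitrary: f g)
  case 0
  then show ?case by (simp add: continuous_on_scaleR)
next
  case (Suc k)
  note lower = Suc.prems[THEN Ck_on_SucD]
  show ?case
  proof (rule Ck_on_SucI[OF assms(1)
        has_derivative_scaleR[OF Suc.prems[THEN Ck_on_has_derivative]]])
    show "Ck_on k U (\<lambda>x. f x *\<^sub>R frechet_derivative g (at x) v +
        frechet_derivative f (at x) v *\<^sub>R g x)" for v
      using Suc.prems by (intro Ck_on_add Suc.IH lower assms(1)) simp_all
  qed
qed

lemma Ck_on_inner_left:
  assumes "open U" "Ck_on k U f"
  shows "Ck_on k U (\<lambda>x. f x \<bullet> b)"
  using assms(2)
proof (induction k arbitrary: f)
  case 0
  then show ?case by (auto intro: continuous_intros)
next
  case (Suc k)
  show ?case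
    by (rule Ck_on_SucI[OF assms(1)
          has_derivative_inner_left[OF Ck_on_has_derivative[OF Suc.prems]]])
       (use Suc in simp_all)
qed

text \<open>The obstacle is that \<open>?g' (f x) (?f' x v)\<close> differentiates \<open>g\<close>
  in a direction that varies with \<open>x\<close>, whereas \<open>Ck_on\<close> speaks only of
  fixed directions. Expanding \<open>?f' x v\<close> in the basis gives a sum of scalar C^k
  functions times derivatives of \<open>g\<close> in fixed directions, composed with
  \<open>f\<close>. To these the induction hypothesis applies, which is why \<open>g\<close> is
  generalized.\<close>

lemma Ck_on_compose:
  fixes f :: "'a::euclidean_space \<Rightarrow> 'b::euclidean_space" and g :: "'b \<Rightarrow> 'c::euclidean_space"
  assumes "open U" "open V" "f ` U \<subseteq> V" "Ck_on k U f" "Ck_on k V g"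
  shows "Ck_on k U (g \<circ> f)"
  using assms(4,5)
proof (induction k arbitrary: g)
  case 0
  then show ?case
    using assms(3) by (metis Ck_on.simps(1) continuous_on_compose continuous_on_subset)
next
  case (Suc k)
  let ?f' = "\<lambda>x. frechet_derivative f (at x)" and ?g' = "\<lambda>y. frechet_derivative g (at y)"
  show ?case
  proof (rule Ck_on_SucI[OF assms(1)])
    fix x assume x: "x \<in> U"
    have "(g \<circ> f has_derivative ?g' (f x) \<circ> ?f' x) (at x)"
      using Suc.prems x assms(3) by (intro diff_chain_at Ck_on_has_derivative) auto
    moreover have "?g' (f x) \<circ> ?f' x = (\<lambda>v. \<Sum>b\<in>Basis. (?f' x v \<bullet> b) *\<^sub>R ?g' (f x) b)"
    proof
      fix v
      have "linear (?g' (f x))"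
        using Ck_on_has_derivative[OF Suc.prems(2)] x assms(3) has_derivative_linear by blast
      then have "?g' (f x) (\<Sum>b\<in>Basis. (?f' x v \<bullet> b) *\<^sub>R b) =
          (\<Sum>b\<in>Basis. (?f' x v \<bullet> b) *\<^sub>R ?g' (f x) b)"
        by (simp add: linear_sum linear_cmul)
      then show "(?g' (f x) \<circ> ?f' x) v = (\<Sum>b\<in>Basis. (?f' x v \<bullet> b) *\<^sub>R ?g' (f x) b)"
        by (simp add: euclidean_representation)
    qed
    ultimately show "(g \<circ> f has_derivative
        (\<lambda>v. \<Sum>b\<in>Basis. (?f' x v \<bullet> b) *\<^sub>R ?g' (f x) b)) (at x)"
      by simp
  next
    fix v
    have "Ck_on k U (\<lambda>x. ?g' (f x) b)" for b
      using Suc.IH[of "\<lambda>y. ?g' y b"] Ck_on_SucD[OF Suc.prems(1)] Suc.prems(2)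
      by (simp add: o_def)
    moreover have "Ck_on k U (\<lambda>x. ?f' x v)"
      using Suc.prems(1) by simp
    ultimately show "Ck_on k U (\<lambda>x. \<Sum>b\<in>Basis. (?f' x v \<bullet> b) *\<^sub>R ?g' (f x) b)"
      by (intro Ck_on_sum Ck_on_scaleR Ck_on_inner_left assms(1))
  qed
qed

section \<open>Smooth maps on arbitrary subsets of Euclidean spaces\<close>

lemma smooth_on_subset:
  assumes "smooth_on X f" "Y \<subseteq> X"
  shows "smooth_on Y f"
  unfolding smooth_on_def
proof
  fix x assume "x \<in> Y"
  then obtain U g where "open U" "x \<in> U" "\<forall>k. Ck_on k U g" "\<forall>y\<in>X \<inter> U. g y = f y"
    using assms unfolding smooth_on_def by (meson subsetD)
  moreover from this have "\<forall>y\<in>Y \<inter> U. g y = f y" using assms(2) by auto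
  ultimately show "\<exists>U g. open U \<and> x \<in> U \<and> (\<forall>k. Ck_on k U g) \<and> (\<forall>y\<in>Y \<inter> U. g y = f y)"
    by (intro exI[of _ U] exI[of _ g] conjI)
qed

lemma smooth_on_cong:
  assumes "\<And>x. x \<in> X \<Longrightarrow> f x = g x"
  shows "smooth_on X f \<longleftrightarrow> smooth_on X g"
proof -
  have "(\<forall>y\<in>X \<inter> U. h y = f y) \<longleftrightarrow> (\<forall>y\<in>X \<inter> U. h y = g y)" for U h
    using assms by simp
  then show ?thesis unfolding smooth_on_def by (simp only:)
qed

lemma smooth_on_bounded_linear:
  assumes "bounded_linear L"
  shows "smooth_on X L"
  unfolding smooth_on_def
  by (intro ballI exI[of _ UNIV] exI[of _ L])
     (simp add: Ck_on_bounded_linear[OF open_UNIV assms])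

lemma smooth_on_compose:
  assumes f: "smooth_on X f" and g: "smooth_on Y g" and sub: "f ` X \<subseteq> Y"
  shows "smooth_on X (g \<circ> f)"
  unfolding smooth_on_def
proof (intro ballI)
  fix x assume x: "x \<in> X"
  obtain O1 F where F: "open O1" "x \<in> O1" "\<And>k. Ck_on k O1 F" "\<And>y. y \<in> X \<inter> O1 \<Longrightarrow> F y = f y"
    using f x unfolding smooth_on_def by meson
  have "f x \<in> Y" using sub x by blast
  then obtain O2 G where G: "open O2" "f x \<in> O2" "\<And>k. Ck_on k O2 G"
      "\<And>y. y \<in> Y \<inter> O2 \<Longrightarrow> G y = g y"
    using g unfolding smooth_on_def by meson
  \<comment> \<open>The extension \<open>F\<close> may take points outside \<open>X\<close>
    anywhere, so its domain is cut down to where \<open>G\<close> is defined on its values. On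
    \<open>X\<close> itself \<open>F\<close> agrees with \<open>f\<close>, whose values lie in
    \<open>Y\<close>.\<close>
  define O3 where "O3 = O1 \<inter> F -` O2"
  have "continuous_on O1 F" using F(3)[of 0] by simp
  then have O3: "open O3" unfolding O3_def
    using F(1) G(1) by (simp add: continuous_open_preimage)
  have "Ck_on k O3 (G \<circ> F)" for k
    by (rule Ck_on_compose[OF O3 G(1) _ Ck_on_subset[OF F(3)] G(3)]) (auto simp: O3_def)
  moreover have "x \<in> O3" using F G x by (auto simp: O3_def)
  moreover have "(G \<circ> F) y = (g \<circ> f) y" if "y \<in> X \<inter> O3" for y
    using that F(4)[of y] G(4)[of "f y"] sub by (auto simp: O3_def)
  ultimately show "\<exists>U h. open U \<and> x \<in> U \<and> (\<forall>k. Ck_on k U h) \<and> (\<forall>y\<in>X \<inter> U. h y = (g \<circ> f) y)"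
    using O3 by blast
qed

text \<open>An extension is required only near each point. A relatively open piece is the trace on
  \<open>X\<close> of an open set \<open>V\<close>, so intersecting the neighbourhood of an
  extension with \<open>V\<close> makes it serve for all of \<open>X\<close>.\<close>

lemma smooth_on_openin_cover:
  assumes "\<And>x. x \<in> X \<Longrightarrow> \<exists>T. openin (top_of_set X) T \<and> x \<in> T \<and> smooth_on T f"
  shows "smooth_on X f"
  unfolding smooth_on_def
proof (intro ballI)
  fix x assume "x \<in> X"
  then obtain V where V: "open V" "x \<in> X \<inter> V" "smooth_on (X \<inter> V) f"
    using assms by (metis openin_open)
  then obtain U g where "open U" "x \<in> U" "\<forall>k. Ck_on k U g" "\<forall>y\<in>X \<inter> V \<inter> U. g y = f y"
    unfolding smooth_on_def by meson
  then have "open (V \<inter> U) \<and> x \<in> V \<inter> U \<and> (\<forall>k. Ck_on k (V \<inter> U) g) \<and>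
      (\<forall>y\<in>X \<inter> (V \<inter> U). g y = f y)"
    using V by (auto intro: Ck_on_subset)
  then show "\<exists>U g. open U \<and> x \<in> U \<and> (\<forall>k. Ck_on k U g) \<and> (\<forall>y\<in>X \<inter> U. g y = f y)"
    by blast
qed

section \<open>Smooth maps between manifolds\<close>

lemma smooth_manifold_chart:
  assumes "smooth_manifold M" "(U, c) \<in> mfd_charts M"
  shows "openin (mfd_topology M) U" "openin (top_of_set (mfd_model M)) (c ` U)"
    "homeomorphic_map (subtopology (mfd_topology M) U) (top_of_set (c ` U)) c" "inj_on c U"
proof -
  show *: "openin (mfd_topology M) U" "openin (top_of_set (mfd_model M)) (c ` U)"
    "homeomorphic_map (subtopology (mfd_topology M) U) (top_of_set (c ` U)) c"
    using assms unfolding smooth_manifold_def by fast+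
  show "inj_on c U"
    using homeomorphic_imp_injective_map[OF *(3)] openin_subset[OF *(1)]
    by (simp add: Int_absorb1)
qed

lemma chart_image_openin:
  assumes "smooth_manifold M" "(U, c) \<in> mfd_charts M" "openin (mfd_topology M) T"
  shows "openin (top_of_set (c ` U)) (c ` (U \<inter> T))"
proof -
  have "openin (subtopology (mfd_topology M) U) (U \<inter> T)"
    using assms(3) by (auto simp: openin_subtopology)
  then show ?thesis
    using smooth_manifold_chart(3)[OF assms(1,2)]
    by (meson homeomorphic_imp_open_map open_map_def)
qed

lemma smooth_on_chart_image:
  assumes "smooth_manifold M" "(U, c) \<in> mfd_charts M" "D \<subseteq> U"
    and "\<And>p. p \<in> D \<Longrightarrow> \<exists>T. openin (mfd_topology M) T \<and> p \<in> T \<and> smooth_on (c ` (D \<inter> T)) g"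
  shows "smooth_on (c ` D) g"
proof (rule smooth_on_openin_cover)
  fix x assume "x \<in> c ` D"
  then obtain p T where p: "x = c p" "p \<in> D" and
    T: "openin (mfd_topology M) T" "p \<in> T" "smooth_on (c ` (D \<inter> T)) g"
    using assms(4) by blast
  have "c ` (D \<inter> T) = c ` D \<inter> c ` (U \<inter> T)"
  proof -
    \<comment> \<open>\<open>c\<close> is known to be injective only on \<open>U\<close>, and
      \<open>T\<close> may stick out of it.\<close>
    have "D \<inter> T = D \<inter> (U \<inter> T)" using assms(3) by blast
    then have "c ` (D \<inter> T) = c ` (D \<inter> (U \<inter> T))" by (rule arg_cong)
    also have "\<dots> = c ` D \<inter> c ` (U \<inter> T)"
      by (rule inj_on_image_Int[OF smooth_manifold_chart(4)[OF assms(1,2)] assms(3) Int_lower1])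
    finally show ?thesis .
  qed
  moreover have "openin (top_of_set (c ` D)) (c ` D \<inter> c ` (U \<inter> T))"
  proof -
    obtain V where V: "open V" "c ` (U \<inter> T) = c ` U \<inter> V"
      using chart_image_openin[OF assms(1,2) T(1)] unfolding openin_open by blast
    have "c ` D \<inter> c ` (U \<inter> T) = c ` D \<inter> V"
      unfolding V(2) using assms(3) by blast
    then show ?thesis using V(1) by (simp add: openin_open_Int)
  qed
  ultimately show "\<exists>T. openin (top_of_set (c ` D)) T \<and> x \<in> T \<and> smooth_on T g"
    using p T by auto
qed

lemma smooth_manifold_coverE:
  assumes "smooth_manifold M" "p \<in> points M"
  obtains U c where "(U, c) \<in> mfd_charts M" "p \<in> U"
  using assms unfolding smooth_manifold_def by blast

section \<open>Smooth maps: local criterion and composition\<close>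

lemma smooth_map_chart:
  assumes "smooth_map M N f" "(U, c) \<in> mfd_charts M" "(V, d) \<in> mfd_charts N"
  shows "smooth_on (c ` {p \<in> U. f p \<in> V}) (d \<circ> f \<circ> inv_into U c)"
  using assms unfolding smooth_map_def by fast

lemma smooth_map_continuous:
  "smooth_map M N f \<Longrightarrow> continuous_map (mfd_topology M) (mfd_topology N) f"
  by (simp add: smooth_map_def)

text \<open>The set \<open>T\<close> may depend on both charts and on the point. This leaves room to
  pick an auxiliary chart around an intermediate value, good only near \<open>p\<close>.\<close>

lemma smooth_mapI:
  assumes M: "smooth_manifold M" and "continuous_map (mfd_topology M) (mfd_topology N) f"
    and loc: "\<And>U c V d p. (U, c) \<in> mfd_charts M \<Longrightarrow> (V, d) \<in> mfd_charts N \<Longrightarrow> p \<in> U \<Longrightarrow> f p \<in> V \<Longrightarrow>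
      \<exists>T. openin (mfd_topology M) T \<and> p \<in> T \<and>
        smooth_on (c ` {p \<in> U \<inter> T. f p \<in> V}) (d \<circ> f \<circ> inv_into U c)"
  shows "smooth_map M N f"
proof -
  have "smooth_on (c ` {p \<in> U. f p \<in> V}) (d \<circ> f \<circ> inv_into U c)"
    if "(U, c) \<in> mfd_charts M" "(V, d) \<in> mfd_charts N" for U c V d
  proof (rule smooth_on_chart_image[OF M that(1)])
    fix p assume "p \<in> {p \<in> U. f p \<in> V}"
    moreover have "{p \<in> U. f p \<in> V} \<inter> T = {p \<in> U \<inter> T. f p \<in> V}" for T by blast
    ultimately show "\<exists>T. openin (mfd_topology M) T \<and> p \<in> T \<and>
        smooth_on (c ` ({p \<in> U. f p \<in> V} \<inter> T)) (d \<circ> f \<circ> inv_into U c)"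
      using loc[OF that] by simp
  qed auto
  then show ?thesis using assms(2) unfolding smooth_map_def by blast
qed

lemma smooth_map_compose:
  assumes M: "smooth_manifold M" and N: "smooth_manifold N"
    and f: "smooth_map M N f" and g: "smooth_map N P g"
  shows "smooth_map M P (g \<circ> f)"
proof -
  have cont: "continuous_map (mfd_topology M) (mfd_topology P) (g \<circ> f)"
    using f g by (meson continuous_map_compose smooth_map_continuous)
  have loc: "\<exists>T. openin (mfd_topology M) T \<and> p \<in> T \<and>
      smooth_on (c ` {q \<in> U \<inter> T. (g \<circ> f) q \<in> V}) (d \<circ> (g \<circ> f) \<circ> inv_into U c)"
    if c: "(U, c) \<in> mfd_charts M" and d: "(V, d) \<in> mfd_charts P" and p: "p \<in> U" for U c V d p
  proof -
    note inj = smooth_manifold_chart(4)[OF M c]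
    note fc = smooth_map_continuous[OF f]
    have "p \<in> points M"
      using openin_subset[OF smooth_manifold_chart(1)[OF M c]] p by blast
    then have "f p \<in> points N" using fc by (auto simp: continuous_map_def)
    then obtain V' d' where d': "(V', d') \<in> mfd_charts N" "f p \<in> V'"
      using smooth_manifold_coverE[OF N] by blast
    note inj' = smooth_manifold_chart(4)[OF N d'(1)]
    \<comment> \<open>On \<open>?T\<close> the map \<open>f\<close> stays inside the single chart
      \<open>(V', d')\<close> of \<open>N\<close>, so the chart expression of the composite factors
      through \<open>d'\<close> and its inverse.\<close>
    let ?T = "{q \<in> points M. f q \<in> V'}" and ?X = "c ` {q \<in> U. f q \<in> V' \<and> g (f q) \<in> V}"
    have "smooth_on ?X (d' \<circ> f \<circ> inv_into U c)"
      by (rule smooth_on_subset[OF smooth_map_chart[OF f c d'(1)]]) blast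
    moreover have "(d' \<circ> f \<circ> inv_into U c) ` ?X \<subseteq> d' ` {q \<in> V'. g q \<in> V}"
      using inj by auto
    ultimately have "smooth_on ?X ((d \<circ> g \<circ> inv_into V' d') \<circ> (d' \<circ> f \<circ> inv_into U c))"
      using smooth_on_compose smooth_map_chart[OF g d'(1) d] by blast
    then have "smooth_on ?X (d \<circ> (g \<circ> f) \<circ> inv_into U c)"
      by (rule smooth_on_cong[THEN iffD1, rotated]) (use inj inj' in auto)
    then have "smooth_on (c ` {q \<in> U \<inter> ?T. (g \<circ> f) q \<in> V}) (d \<circ> (g \<circ> f) \<circ> inv_into U c)"
      by (rule smooth_on_subset) auto
    moreover have "openin (mfd_topology M) ?T"
      using openin_continuous_map_preimage[OF fc smooth_manifold_chart(1)[OF N d'(1)]] .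
    ultimately show ?thesis
      using \<open>p \<in> points M\<close> d'(2) by (intro exI[of _ ?T]) simp
  qed
  show ?thesis
    by (rule smooth_mapI[OF M cont]) (use loc in simp)
qed

section \<open>Components of maps into a product\<close>

lemma prod_manifold_chartsI:
  "(U, c) \<in> mfd_charts M \<Longrightarrow> (V, d) \<in> mfd_charts N \<Longrightarrow>
    (U \<times> V, map_prod c d) \<in> mfd_charts (prod_manifold M N)"
  by (auto simp: prod_manifold_def)

lemma mfd_topology_prod [simp]:
  "mfd_topology (prod_manifold M N) = prod_topology (mfd_topology M) (mfd_topology N)"
  by (simp add: prod_manifold_def)

text \<open>The charts of a product are products of charts. A chart \<open>d\<close> of
  \<open>N\<close> must first be paired with a chart \<open>d'\<close> of \<open>P\<close> around
  the second component. The expression of \<open>fst \<circ> f\<close> is then the linear projection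
  \<open>fst\<close> after that of \<open>f\<close>.\<close>

lemma smooth_map_fst_of:
  assumes M: "smooth_manifold M" and P: "smooth_manifold P"
    and f: "smooth_map M (prod_manifold N P) f"
  shows "smooth_map M N (fst \<circ> f)"
proof -
  note fc = smooth_map_continuous[OF f, unfolded mfd_topology_prod]
  have cont: "continuous_map (mfd_topology M) (mfd_topology N) (fst \<circ> f)"
    using fc by (rule continuous_map_fst_of)
  have sc: "continuous_map (mfd_topology M) (mfd_topology P) (snd \<circ> f)"
    using fc by (rule continuous_map_snd_of)
  have loc: "\<exists>T. openin (mfd_topology M) T \<and> p \<in> T \<and>
      smooth_on (c ` {q \<in> U \<inter> T. (fst \<circ> f) q \<in> V}) (d \<circ> (fst \<circ> f) \<circ> inv_into U c)"
    if c: "(U, c) \<in> mfd_charts M" and d: "(V, d) \<in> mfd_charts N" and p: "p \<in> U" for U c V d p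
  proof -
    have pM: "p \<in> points M"
      using openin_subset[OF smooth_manifold_chart(1)[OF M c]] p by blast
    then have "(snd \<circ> f) p \<in> points P" using continuous_map_image_subset_topspace[OF sc] by blast
    then obtain V' d' where d': "(V', d') \<in> mfd_charts P" "(snd \<circ> f) p \<in> V'"
      using smooth_manifold_coverE[OF P] by blast
    let ?T = "{q \<in> points M. (snd \<circ> f) q \<in> V'}" and ?X = "c ` {q \<in> U. f q \<in> V \<times> V'}"
    have "smooth_on ?X (fst \<circ> (map_prod d d' \<circ> f \<circ> inv_into U c))"
      by (rule smooth_on_compose[OF smooth_map_chart[OF f c prod_manifold_chartsI[OF d d'(1)]]
            smooth_on_bounded_linear[OF bounded_linear_fst] subset_UNIV])
    then have "smooth_on ?X (d \<circ> (fst \<circ> f) \<circ> inv_into U c)"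
      by (rule smooth_on_cong[THEN iffD1, rotated]) auto
    then have "smooth_on (c ` {q \<in> U \<inter> ?T. (fst \<circ> f) q \<in> V}) (d \<circ> (fst \<circ> f) \<circ> inv_into U c)"
      by (rule smooth_on_subset) (auto simp: mem_Times_iff)
    moreover have "openin (mfd_topology M) ?T"
      using openin_continuous_map_preimage[OF sc smooth_manifold_chart(1)[OF P d'(1)]] .
    ultimately show ?thesis
      using pM d'(2) by (intro exI[of _ ?T]) simp
  qed
  show ?thesis
    by (rule smooth_mapI[OF M cont]) (use loc in simp)
qed

lemma smooth_map_snd_of:
  assumes M: "smooth_manifold M" and N: "smooth_manifold N"
    and f: "smooth_map M (prod_manifold N P) f"
  shows "smooth_map M P (snd \<circ> f)"
proof -
  note fc = smooth_map_continuous[OF f, unfolded mfd_topology_prod]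
  have cont: "continuous_map (mfd_topology M) (mfd_topology P) (snd \<circ> f)"
    using fc by (rule continuous_map_snd_of)
  have sc: "continuous_map (mfd_topology M) (mfd_topology N) (fst \<circ> f)"
    using fc by (rule continuous_map_fst_of)
  have loc: "\<exists>T. openin (mfd_topology M) T \<and> p \<in> T \<and>
      smooth_on (c ` {q \<in> U \<inter> T. (snd \<circ> f) q \<in> V}) (d \<circ> (snd \<circ> f) \<circ> inv_into U c)"
    if c: "(U, c) \<in> mfd_charts M" and d: "(V, d) \<in> mfd_charts P" and p: "p \<in> U" for U c V d p
  proof -
    have pM: "p \<in> points M"
      using openin_subset[OF smooth_manifold_chart(1)[OF M c]] p by blast
    then have "(fst \<circ> f) p \<in> points N" using continuous_map_image_subset_topspace[OF sc] by blast
    then obtain V' d' where d': "(V', d') \<in> mfd_charts N" "(fst \<circ> f) p \<in> V'"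
      using smooth_manifold_coverE[OF N] by blast
    let ?T = "{q \<in> points M. (fst \<circ> f) q \<in> V'}" and ?X = "c ` {q \<in> U. f q \<in> V' \<times> V}"
    have "smooth_on ?X (snd \<circ> (map_prod d' d \<circ> f \<circ> inv_into U c))"
      by (rule smooth_on_compose[OF smooth_map_chart[OF f c prod_manifold_chartsI[OF d'(1) d]]
            smooth_on_bounded_linear[OF bounded_linear_snd] subset_UNIV])
    then have "smooth_on ?X (d \<circ> (snd \<circ> f) \<circ> inv_into U c)"
      by (rule smooth_on_cong[THEN iffD1, rotated]) auto
    then have "smooth_on (c ` {q \<in> U \<inter> ?T. (snd \<circ> f) q \<in> V}) (d \<circ> (snd \<circ> f) \<circ> inv_into U c)"
      by (rule smooth_on_subset) (auto simp: mem_Times_iff)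
    moreover have "openin (mfd_topology M) ?T"
      using openin_continuous_map_preimage[OF sc smooth_manifold_chart(1)[OF N d'(1)]] .
    ultimately show ?thesis
      using pM d'(2) by (intro exI[of _ ?T]) simp
  qed
  show ?thesis
    by (rule smooth_mapI[OF M cont]) (use loc in simp)
qed

section \<open>Open submanifolds and gluing\<close>

lemma mfd_topology_open_submanifold [simp]:
  "mfd_topology (open_submanifold M T) = subtopology (mfd_topology M) T"
  by (simp add: open_submanifold_def)

text \<open>Restricting a chart to a smaller domain changes the term for its inverse, but not the
  values on the smaller image.\<close>

lemma inv_into_subset: "inj_on f A \<Longrightarrow> B \<subseteq> A \<Longrightarrow> y \<in> f ` B \<Longrightarrow> inv_into B f y = inv_into A f y"
  by (metis f_inv_into_f inv_into_f_eq inv_into_into subsetD)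

text \<open>A bundle chart is smooth on the part of \<open>M\<close> over its base domain, and the
  composition and projection lemmas apply there only once that part is a manifold.\<close>

lemma smooth_manifold_open_submanifold:
  assumes M: "smooth_manifold M" and T: "openin (mfd_topology M) T"
  shows "smooth_manifold (open_submanifold M T)"
proof -
  have chart: "openin (mfd_topology (open_submanifold M T)) U' \<and>
      openin (top_of_set (mfd_model M)) (c ` U') \<and>
      homeomorphic_map (subtopology (mfd_topology (open_submanifold M T)) U') (top_of_set (c ` U')) c"
    if U': "U' = U \<inter> T" and c: "(U, c) \<in> mfd_charts M" for U U' c
  proof (intro conjI)
    note UM = smooth_manifold_chart[OF M c]
    show "openin (mfd_topology (open_submanifold M T)) U'"
      using UM(1) by (auto simp: openin_subtopology U')
    show "openin (top_of_set (mfd_model M)) (c ` U')"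
      \<comment> \<open>\<open>c\<close> U'\<open>is open in\<close>c \<open>U\<close>, which is
        open in the model.\<close>
      using chart_image_openin[OF M c T] UM(2) U' openin_trans by blast
    have "homeomorphic_map (subtopology (subtopology (mfd_topology M) U) U')
        (subtopology (top_of_set (c ` U)) (c ` U')) c"
      using homeomorphic_map_subtopologies[OF UM(3)] openin_subset[OF UM(1)] UM(4) U'
      by (metis (no_types, lifting) Int_absorb1 Int_absorb2 Int_lower1 image_mono
        topspace_euclidean_subtopology topspace_subtopology)
    moreover have "subtopology (top_of_set (c ` U)) (c ` U') = top_of_set (c ` U')"
      by (simp add: subtopology_subtopology U' Int_absorb1 image_mono)
    ultimately show "homeomorphic_map (subtopology (mfd_topology (open_submanifold M T)) U')
        (top_of_set (c ` U')) c"
      by (simp add: subtopology_subtopology U' Int_commute Int_left_commute)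
  qed
  have trans: "smooth_on (c ` (U \<inter> T \<inter> (V \<inter> T))) (d \<circ> inv_into (U \<inter> T) c)"
    if c: "(U, c) \<in> mfd_charts M" and d: "(V, d) \<in> mfd_charts M" for U c V d
  proof -
    have "smooth_on (c ` (U \<inter> V)) (d \<circ> inv_into U c)"
      using M that unfolding smooth_manifold_def by fast
    then have "smooth_on (c ` (U \<inter> T \<inter> (V \<inter> T))) (d \<circ> inv_into U c)"
      by (rule smooth_on_subset) blast
    then show ?thesis
    proof (rule smooth_on_cong[THEN iffD1, rotated])
      fix x assume "x \<in> c ` (U \<inter> T \<inter> (V \<inter> T))"
      then show "(d \<circ> inv_into U c) x = (d \<circ> inv_into (U \<inter> T) c) x"
        using inv_into_subset[OF smooth_manifold_chart(4)[OF M c], of "U \<inter> T" x] by auto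
    qed
  qed
  have "points M = (\<Union>(U, c) \<in> mfd_charts M. U)"
    using M unfolding smooth_manifold_def by blast
  then have cover: "points (open_submanifold M T) =
      (\<Union>(U, c) \<in> mfd_charts (open_submanifold M T). U)"
    by (auto simp: open_submanifold_def)
  have "Hausdorff_space (mfd_topology (open_submanifold M T))"
    "second_countable (mfd_topology (open_submanifold M T))"
    "subspace (mfd_model (open_submanifold M T))"
    using M unfolding smooth_manifold_def
    by (auto simp: open_submanifold_def Hausdorff_space_subtopology second_countable_subtopology)
  moreover have "\<forall>(U, c) \<in> mfd_charts (open_submanifold M T).
      openin (mfd_topology (open_submanifold M T)) U \<and>
      openin (top_of_set (mfd_model (open_submanifold M T))) (c ` U) \<and>
      homeomorphic_map (subtopology (mfd_topology (open_submanifold M T)) U) (top_of_set (c ` U)) c"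
    using chart by (force simp: open_submanifold_def)
  moreover have "\<forall>(U, c) \<in> mfd_charts (open_submanifold M T).
      \<forall>(V, d) \<in> mfd_charts (open_submanifold M T).
        smooth_on (c ` (U \<inter> V)) (d \<circ> inv_into U c)"
    using trans by (fastforce simp: open_submanifold_def)
  ultimately show ?thesis
    using cover unfolding smooth_manifold_def by blast
qed

text \<open>The local maps \<open>g i\<close> are kept apart from \<open>f\<close> because the
  intended \<open>f\<close> is given by a choice at each point, whereas each \<open>g i\<close> has
  one formula on all of \<open>T i\<close>. Continuity comes from pasting, smoothness from the
  charts of \<open>M\<close> restricted to \<open>T i\<close>.\<close>

lemma smooth_map_open_cover:
  assumes M: "smooth_manifold M"
    and T: "\<And>i. i \<in> I \<Longrightarrow> openin (mfd_topology M) (T i)" and cover: "points M \<subseteq> (\<Union>i\<in>I. T i)"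
    and g: "\<And>i. i \<in> I \<Longrightarrow> smooth_map (open_submanifold M (T i)) N (g i)"
    and eq: "\<And>i p. i \<in> I \<Longrightarrow> p \<in> T i \<Longrightarrow> f p = g i p"
  shows "smooth_map M N f"
proof -
  have cont: "continuous_map (mfd_topology M) (mfd_topology N) f"
  proof (rule pasting_lemma[where I = I and T = T and f = g])
    show "continuous_map (subtopology (mfd_topology M) (T i)) (mfd_topology N) (g i)"
      if "i \<in> I" for i
      using smooth_map_continuous[OF g[OF that]] by simp
    show "g i x = g j x" if "i \<in> I" "j \<in> I" "x \<in> points M \<inter> T i \<inter> T j" for i j x
      using that eq[of i x] eq[of j x] by simp
    show "\<exists>j. j \<in> I \<and> x \<in> T j \<and> f x = g j x" if x: "x \<in> points M" for x
    proof -
      obtain j where "j \<in> I" "x \<in> T j" using x cover by blast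
      then show ?thesis using eq[of j x] by blast
    qed
  qed (rule T)
  have loc: "\<exists>T. openin (mfd_topology M) T \<and> p \<in> T \<and>
      smooth_on (c ` {p \<in> U \<inter> T. f p \<in> V}) (d \<circ> f \<circ> inv_into U c)"
    if c: "(U, c) \<in> mfd_charts M" and d: "(V, d) \<in> mfd_charts N" and p: "p \<in> U" for U c V d p
  proof -
    have "p \<in> points M"
      using openin_subset[OF smooth_manifold_chart(1)[OF M c]] p by blast
    then obtain i where i: "i \<in> I" "p \<in> T i" using cover by blast
    have "(U \<inter> T i, c) \<in> mfd_charts (open_submanifold M (T i))"
      using imageI[OF c, of "\<lambda>(U, c). (U \<inter> T i, c)"] by (simp add: open_submanifold_def)
    from smooth_map_chart[OF g[OF i(1)] this d]
    have "smooth_on (c ` {p \<in> U \<inter> T i. g i p \<in> V}) (d \<circ> g i \<circ> inv_into (U \<inter> T i) c)" .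
    moreover have "{p \<in> U \<inter> T i. g i p \<in> V} = {p \<in> U \<inter> T i. f p \<in> V}"
      using eq[OF i(1)] by auto
    ultimately have "smooth_on (c ` {p \<in> U \<inter> T i. f p \<in> V}) (d \<circ> g i \<circ> inv_into (U \<inter> T i) c)"
      by simp
    then have "smooth_on (c ` {p \<in> U \<inter> T i. f p \<in> V}) (d \<circ> f \<circ> inv_into U c)"
    proof (rule smooth_on_cong[THEN iffD1, rotated])
      fix x assume x: "x \<in> c ` {p \<in> U \<inter> T i. f p \<in> V}"
      then have "inv_into (U \<inter> T i) c x = inv_into U c x"
        by (intro inv_into_subset[OF smooth_manifold_chart(4)[OF M c]]) auto
      moreover have "inv_into (U \<inter> T i) c x \<in> T i"
        using x inv_into_into[of x c "U \<inter> T i"] by blast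
      ultimately show "(d \<circ> g i \<circ> inv_into (U \<inter> T i) c) x = (d \<circ> f \<circ> inv_into U c) x"
        using eq[OF i(1)] by simp
    qed
    then show ?thesis
      using T[OF i(1)] i(2) by (intro exI[of _ "T i"]) simp
  qed
  show ?thesis
    by (rule smooth_mapI[OF M cont]) (use loc in simp)
qed

section \<open>Multi-fiber atlases\<close>

text \<open>The point \<open>p\<close> lies on its own S-fiber and
  \<open>h_part \<phi> \<beta>\<close> is injective there, so inverting it at
  \<open>h_part \<phi> \<beta> p\<close> gives back \<open>p\<close>. Membership in
  \<open>points S\<close> matters because \<open>h_transition\<close> is extensional.\<close>

lemma h_transition_h_part:
  assumes atlas: "multi_fiber_atlas M B S W \<pi> A U \<phi>"
    and "\<alpha> \<in> A" "\<beta> \<in> A" and p: "p \<in> over M \<pi> (U \<alpha> \<inter> U \<beta>)"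
  shows "h_part \<phi> \<beta> p \<in> points S"
    and "h_transition M S \<pi> A U \<phi> \<alpha> \<beta> p (h_part \<phi> \<beta> p) = h_part \<phi> \<alpha> p"
proof -
  let ?F = "S_slice M S \<pi> U \<phi> \<beta> p"
  have p\<beta>: "p \<in> over M \<pi> (U \<beta>)" using p by (simp add: over_def)
  have chart: "bundle_chart M B (prod_manifold S W) \<pi> (U \<beta>) (\<phi> \<beta>)"
    using atlas \<open>\<beta> \<in> A\<close> by (auto simp: multi_fiber_atlas_def bundle_atlas_def)
  have "points M \<inter> over M \<pi> (U \<beta>) = over M \<pi> (U \<beta>)" by (auto simp: over_def)
  then have bij: "bij_betw (\<phi> \<beta>) (over M \<pi> (U \<beta>))
      (points (prod_manifold (open_submanifold B (U \<beta>)) (prod_manifold S W)))"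
    using chart unfolding bundle_chart_def diffeomorphism_def by simp
  then show S: "h_part \<phi> \<beta> p \<in> points S"
    using p\<beta> bij_betwE by (fastforce simp: h_part_def)
  have "fst (\<phi> \<beta> p) = \<pi> p" using chart p\<beta> by (simp add: bundle_chart_def)
  then have pF: "p \<in> ?F"
    using p\<beta> S by (auto simp: S_slice_def h_part_def f_part_def mem_Times_iff)
  \<comment> \<open>On the slice the base point and the \<open>W\<close>-component are fixed, so the
    \<open>S\<close>-component determines \<open>\<phi> \<beta> q\<close>, and hence
    \<open>q\<close>.\<close>
  have inj: "inj_on (h_part \<phi> \<beta>) ?F"
  proof (rule inj_onI)
    fix q r assume "q \<in> ?F" "r \<in> ?F" "h_part \<phi> \<beta> q = h_part \<phi> \<beta> r"
    then have "\<phi> \<beta> q = \<phi> \<beta> r" "q \<in> over M \<pi> (U \<beta>)" "r \<in> over M \<pi> (U \<beta>)"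
      by (auto simp: S_slice_def h_part_def mem_Times_iff prod_eq_iff)
    then show "q = r" using inj_onD[OF bij_betw_imp_inj_on[OF bij]] by blast
  qed
  \<comment> \<open>Condition (i) makes the description by \<open>THE\<close> unique: every chart
    \<open>\<gamma>\<close> around \<open>\<pi> p\<close> gives the same slice as
    \<open>\<beta>\<close>. The fiber can thus be computed in the chart whose \<open>h_part\<close>
    is inverted.\<close>
  have "S_fiber M S \<pi> A U \<phi> p = ?F"
    unfolding S_fiber_def
  proof (rule the_equality)
    show "\<exists>\<alpha>\<in>A. \<pi> p \<in> U \<alpha> \<and> ?F = S_slice M S \<pi> U \<phi> \<alpha> p"
      using \<open>\<beta> \<in> A\<close> p by (auto simp: over_def)
    fix F assume "\<exists>\<alpha>\<in>A. \<pi> p \<in> U \<alpha> \<and> F = S_slice M S \<pi> U \<phi> \<alpha> p"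
    then obtain \<gamma> where "\<gamma> \<in> A" "\<pi> p \<in> U \<gamma>" "F = S_slice M S \<pi> U \<phi> \<gamma> p" by blast
    moreover from this have "p \<in> over M \<pi> (U \<gamma> \<inter> U \<beta>)"
      using p by (simp add: over_def)
    ultimately show "F = ?F"
      using atlas \<open>\<beta> \<in> A\<close> by (auto simp: multi_fiber_atlas_def)
  qed
  then show "h_transition M S \<pi> A U \<phi> \<alpha> \<beta> p (h_part \<phi> \<beta> p) = h_part \<phi> \<alpha> p"
    using S inv_into_f_f[OF inj pF] by (simp add: h_transition_def)
qed

lemma invariant_h_part_eq:
  assumes "multi_fiber_atlas M B S W \<pi> A U \<phi>"
    and "invariant_under (transition_group M S \<pi> A U \<phi>) S f"
    and "\<alpha> \<in> A" "\<beta> \<in> A" "p \<in> over M \<pi> (U \<alpha> \<inter> U \<beta>)"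
  shows "f (h_part \<phi> \<alpha> p) = f (h_part \<phi> \<beta> p)"
proof -
  have "h_transition M S \<pi> A U \<phi> \<alpha> \<beta> p \<in> transition_group M S \<pi> A U \<phi>"
    unfolding transition_group_def using assms(3-5) by (blast intro: generate.incl)
  then show ?thesis
    using assms(2) h_transition_h_part[OF assms(1,3-5)] by (fastforce simp: invariant_under_def)
qed

lemma smooth_map_h_part:
  assumes M: "smooth_manifold M" and B: "smooth_manifold B" and S: "smooth_manifold S"
    and W: "smooth_manifold W" and op: "openin (mfd_topology M) (over M \<pi> (U \<alpha>))"
    and chart: "bundle_chart M B (prod_manifold S W) \<pi> (U \<alpha>) (\<phi> \<alpha>)"
  shows "smooth_map (open_submanifold M (over M \<pi> (U \<alpha>))) S (h_part \<phi> \<alpha>)"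
proof -
  let ?M = "open_submanifold M (over M \<pi> (U \<alpha>))" and ?B = "open_submanifold B (U \<alpha>)"
  have M': "smooth_manifold ?M" and B': "smooth_manifold ?B"
    using M B op chart by (auto simp: bundle_chart_def intro: smooth_manifold_open_submanifold)
  have "smooth_map ?M (prod_manifold ?B (prod_manifold S W)) (\<phi> \<alpha>)"
    using chart by (simp add: bundle_chart_def diffeomorphism_def)
  \<comment> \<open>The target is nested as base times (\<open>S\<close> times \<open>W\<close>), so
    \<open>snd\<close> drops the base and \<open>fst\<close> then drops \<open>W\<close>; in each
    case the dropped factor has to be a manifold.\<close>
  then have "smooth_map ?M S (fst \<circ> (snd \<circ> \<phi> \<alpha>))"
    by (intro smooth_map_fst_of[OF M' W] smooth_map_snd_of[OF M' B'])
  moreover have "fst \<circ> (snd \<circ> \<phi> \<alpha>) = h_part \<phi> \<alpha>"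
    by (simp add: fun_eq_iff h_part_def)
  ultimately show ?thesis by simp
qed

theorem mainTheorem2:
  fixes M :: "('m, 'em::euclidean_space) manifold"
    and B :: "('b, 'eb::euclidean_space) manifold"
    and S :: "('s, 'es::euclidean_space) manifold"
    and W :: "('w, 'ew::euclidean_space) manifold"
    and \<pi> :: "'m \<Rightarrow> 'b"
    and A :: "'i set" and U :: "'i \<Rightarrow> 'b set" and \<phi> :: "'i \<Rightarrow> 'm \<Rightarrow> 'b \<times> 's \<times> 'w"
    and f :: "'s \<Rightarrow> real"
  assumes "compact_manifold S" and "compact_manifold W"
    and "multi_fiber_bundle M B S W \<pi>"
    and "multi_fiber_atlas M B S W \<pi> A U \<phi>"
    and "f \<in> C_infinity S"
    and "invariant_under (transition_group M S \<pi> A U \<phi>) S f"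
  shows "(\<forall>\<alpha>\<in>A. \<forall>\<beta>\<in>A. \<forall>p \<in> over M \<pi> (U \<alpha> \<inter> U \<beta>). f (h_part \<phi> \<alpha> p) = f (h_part \<phi> \<beta> p)) \<and>
    (\<exists>ft \<in> C_infinity M. \<forall>\<alpha>\<in>A. \<forall>p \<in> over M \<pi> (U \<alpha>). ft p = f (h_part \<phi> \<alpha> p))"
proof (rule conjI)
  show eq: "\<forall>\<alpha>\<in>A. \<forall>\<beta>\<in>A. \<forall>p \<in> over M \<pi> (U \<alpha> \<inter> U \<beta>). f (h_part \<phi> \<alpha> p) = f (h_part \<phi> \<beta> p)"
    using invariant_h_part_eq[OF assms(4,6)] by blast
  have mfd: "smooth_manifold M" "smooth_manifold B" "smooth_manifold S" "smooth_manifold W"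
    and \<pi>: "smooth_map M B \<pi>"
    using assms(1-3) by (auto simp: compact_manifold_def multi_fiber_bundle_def fiber_bundle_def)
  have chart: "\<And>\<alpha>. \<alpha> \<in> A \<Longrightarrow> bundle_chart M B (prod_manifold S W) \<pi> (U \<alpha>) (\<phi> \<alpha>)"
    and cover: "(\<Union>\<alpha>\<in>A. U \<alpha>) = points B"
    using assms(4) by (auto simp: multi_fiber_atlas_def bundle_atlas_def)
  have op: "openin (mfd_topology M) (over M \<pi> (U \<alpha>))" if "\<alpha> \<in> A" for \<alpha>
    using openin_continuous_map_preimage[OF smooth_map_continuous[OF \<pi>]] chart[OF that]
    by (simp add: bundle_chart_def over_def)
  \<comment> \<open>The chart is chosen anew at each point, so smoothness is not visible from this
    formula. Independence of the chart turns it into the fixed formula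
    \<open>f \<circ> h_part \<phi> \<alpha>\<close> over each \<open>U \<alpha>\<close>.\<close>
  define ft where "ft p = f (h_part \<phi> (SOME \<alpha>. \<alpha> \<in> A \<and> \<pi> p \<in> U \<alpha>) p)" for p
  have ft: "ft p = f (h_part \<phi> \<alpha> p)" if "\<alpha> \<in> A" "p \<in> over M \<pi> (U \<alpha>)" for \<alpha> p
  proof -
    let ?\<beta> = "SOME \<alpha>. \<alpha> \<in> A \<and> \<pi> p \<in> U \<alpha>"
    have "\<exists>\<alpha>. \<alpha> \<in> A \<and> \<pi> p \<in> U \<alpha>" using that by (auto simp: over_def)
    from someI_ex[OF this] have "?\<beta> \<in> A" "\<pi> p \<in> U ?\<beta>" by blast+
    moreover from this(2) have "p \<in> over M \<pi> (U ?\<beta> \<inter> U \<alpha>)" using that(2) by (simp add: over_def)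
    ultimately show ?thesis unfolding ft_def using eq that(1) by (meson bspec)
  qed
  have "smooth_map M real_line ft"
  \<comment> \<open>The preimages of the \<open>U \<alpha>\<close> are open by continuity of
    \<open>\<pi>\<close> and cover \<open>M\<close> because \<open>\<pi>\<close> maps into
    \<open>points B\<close>; the local maps are
    \<open>f \<circ> h_part \<phi> \<alpha>\<close>.\<close>
  proof (rule smooth_map_open_cover[OF mfd(1) op])
    have "\<pi> p \<in> points B" if "p \<in> points M" for p
      using continuous_map_image_subset_topspace[OF smooth_map_continuous[OF \<pi>]] that by blast
    then show "points M \<subseteq> (\<Union>\<alpha>\<in>A. over M \<pi> (U \<alpha>))"
      using cover by (fastforce simp: over_def)
    show "smooth_map (open_submanifold M (over M \<pi> (U \<alpha>))) real_line (f \<circ> h_part \<phi> \<alpha>)"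
      if "\<alpha> \<in> A" for \<alpha>
    proof (rule smooth_map_compose[OF _ mfd(3)])
      show "smooth_manifold (open_submanifold M (over M \<pi> (U \<alpha>)))"
        by (rule smooth_manifold_open_submanifold[OF mfd(1) op[OF that]])
      show "smooth_map (open_submanifold M (over M \<pi> (U \<alpha>))) S (h_part \<phi> \<alpha>)"
        by (rule smooth_map_h_part[where U = U and \<alpha> = \<alpha> and \<phi> = \<phi>, OF mfd op[OF that] chart[OF that]])
      show "smooth_map S real_line f" using assms(5) by (simp add: C_infinity_def)
    qed
    show "ft p = (f \<circ> h_part \<phi> \<alpha>) p" if "\<alpha> \<in> A" "p \<in> over M \<pi> (U \<alpha>)" for \<alpha> p
      using ft[OF that] by simp
  qed
  then show "\<exists>ft \<in> C_infinity M. \<forall>\<alpha>\<in>A. \<forall>p \<in> over M \<pi> (U \<alpha>). ft p = f (h_part \<phi> \<alpha> p)"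
    using ft by (intro bexI[of _ ft]) (simp_all add: C_infinity_def)
qed

end
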